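(* Let $X,Y,E$ be real Banach spaces and $\mathscr B=\operatorname{BLip}_0(X,Y;E)$. For $a\in X$, $b\in Y$ and $T\in\mathscr B$, define mappings $X\times Y\to E$ by $$(\rho_a^X(T))(x,y)=T(x+a,y)-T(a,y),\qquad(\rho_b^Y(T))(x,y)=T(x,y+b)-T(x,b).$$ Then for every $a\in X$ and $b\in Y$, these formulas define surjective linear isometries $\rho_a^X,\rho_b^Y\colon\mathscr B\to\mathscr B$, which satisfy $$\rho_a^X\rho_c^X=\rho_{a+c}^X,\qquad\rho_b^Y\rho_d^Y=\rho_{b+d}^Y,\qquad\rho_a^X\rho_b^Y=\rho_b^Y\rho_a^X$$ for all $c\in X$, $d\in Y$. Consequently, the operators $\rho_{(a,b)}(T):=\rho_a^X(\rho_b^Y(T))$ define an isometric representation of the additive group $X\times Y$ on $\mathscr B$; explicitly, $$(\rho_{(a,b)}(T))(x,y)=T(x+a,y+b)-T(x+a,b)-T(a,y+b)+T(a,b).$$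
   Context: $\operatorname{BLip}_0(X,Y;E)$ is the Banach space of all mappings $T\colon X\times Y\to E$ such that $T(x,0)=T(0,y)=0$ for all $x\in X$, $y\in Y$, and for some $C\ge0$, $\|T(x,y)-T(x',y)-T(x,y')+T(x',y')\|\le C\|x-x'\|\|y-y'\|$ for all $x,x'\in X$, $y,y'\in Y$; its norm $\|T\|_{\operatorname{BLip}}$ is the least admissible $C$. Products of operators denote composition. An isometric representation of a group on a Banach space is a homomorphism from the group into the group of surjective linear isometries (no continuity is assumed). *)

theory Defs
  imports "HOL-Analysis.Analysis" "HOL-Algebra.Group"
begin

section \<open>The Banach space of two-Lipschitz mappings vanishing on the axes\<close>

definition mixed_diff :: "('x \<times> 'y \<Rightarrow> 'e::ab_group_add) \<Rightarrow> 'x \<Rightarrow> 'x \<Rightarrow> 'y \<Rightarrow> 'y \<Rightarrow> 'e" where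
  "mixed_diff T x x' y y' = T (x, y) - T (x', y) - T (x, y') + T (x', y')"

definition blip_bound ::
  "('x::real_normed_vector \<times> 'y::real_normed_vector \<Rightarrow> 'e::real_normed_vector) \<Rightarrow> real \<Rightarrow> bool" where
  "blip_bound T C \<longleftrightarrow>
     0 \<le> C \<and> (\<forall>x x' y y'. norm (mixed_diff T x x' y y') \<le> C * norm (x - x') * norm (y - y'))"

definition BLip0_maps ::
  "('x::real_normed_vector \<times> 'y::real_normed_vector \<Rightarrow> 'e::real_normed_vector) set" where
  "BLip0_maps = {T. (\<forall>x. T (x, 0) = 0) \<and> (\<forall>y. T (0, y) = 0) \<and> (\<exists>C. blip_bound T C)}"

lemma blip_boundD:
  "blip_bound T C \<Longrightarrow> norm (mixed_diff T x x' y y') \<le> C * norm (x - x') * norm (y - y')"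
  by (simp add: blip_bound_def)

lemma blip_bound_zero: "blip_bound (\<lambda>_. 0) 0"
  by (simp add: blip_bound_def mixed_diff_def)

lemma blip_bound_add:
  assumes "blip_bound S C" "blip_bound T D"
  shows "blip_bound (\<lambda>p. S p + T p) (C + D)"
proof -
  have "norm (mixed_diff (\<lambda>p. S p + T p) x x' y y') \<le> (C + D) * norm (x - x') * norm (y - y')"
    for x x' y y'
  proof -
    have "mixed_diff (\<lambda>p. S p + T p) x x' y y' = mixed_diff S x x' y y' + mixed_diff T x x' y y'"
      by (simp add: mixed_diff_def)
    then show ?thesis
      using norm_triangle_mono[OF blip_boundD[OF assms(1)] blip_boundD[OF assms(2)], of x x' y y' x x' y y']
      by (simp add: algebra_simps)
  qed
  then show ?thesis
    using assms by (simp add: blip_bound_def)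
qed

lemma blip_bound_scaleR:
  assumes "blip_bound T C"
  shows "blip_bound (\<lambda>p. r *\<^sub>R T p) (\<bar>r\<bar> * C)"
proof -
  have "norm (mixed_diff (\<lambda>p. r *\<^sub>R T p) x x' y y') \<le> \<bar>r\<bar> * C * norm (x - x') * norm (y - y')"
    for x x' y y'
  proof -
    have "mixed_diff (\<lambda>p. r *\<^sub>R T p) x x' y y' = r *\<^sub>R mixed_diff T x x' y y'"
      by (simp add: mixed_diff_def algebra_simps)
    then show ?thesis
      using mult_left_mono[OF blip_boundD[OF assms, of x x' y y'], of "\<bar>r\<bar>"]
      by (simp add: algebra_simps)
  qed
  then show ?thesis
    using assms by (simp add: blip_bound_def)
qed

lemma blip_bound_uminus: "blip_bound T C \<Longrightarrow> blip_bound (\<lambda>p. - T p) C"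
  using blip_bound_scaleR[of T C "-1"] by simp

lemma blip_bound_diff:
  "blip_bound S C \<Longrightarrow> blip_bound T D \<Longrightarrow> blip_bound (\<lambda>p. S p - T p) (C + D)"
  using blip_bound_add[OF _ blip_bound_uminus, of S C T D] by simp

lemma least_blip_bound:
  fixes T :: "'x::real_normed_vector \<times> 'y::real_normed_vector \<Rightarrow> 'e::real_normed_vector"
  assumes "\<exists>C. blip_bound T C"
  shows "blip_bound T (LEAST C. blip_bound T C)"
    and "blip_bound T D \<Longrightarrow> (LEAST C. blip_bound T C) \<le> D"
proof -
  let ?A = "{C. blip_bound T C}"
  have bdd: "bdd_below ?A"
    by (rule bdd_belowI[of _ 0]) (simp add: blip_bound_def)
  have ne: "?A \<noteq> {}"
    using assms by blast
  have nonneg: "0 \<le> Inf ?A"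
    using ne by (intro cInf_greatest) (auto simp: blip_bound_def)
  have "norm (mixed_diff T x x' y y') \<le> Inf ?A * norm (x - x') * norm (y - y')" for x x' y y'
  proof (cases "norm (x - x') * norm (y - y') = 0")
    case True
    obtain C where "blip_bound T C" using assms by blast
    from blip_boundD[OF this, of x x' y y'] True show ?thesis
      by (auto simp: mult.assoc)
  next
    case False
    then have pos: "0 < norm (x - x') * norm (y - y')"
      by simp
    have "norm (mixed_diff T x x' y y') / (norm (x - x') * norm (y - y')) \<le> Inf ?A"
    proof (rule cInf_greatest[OF ne])
      fix C assume "C \<in> ?A"
      then show "norm (mixed_diff T x x' y y') / (norm (x - x') * norm (y - y')) \<le> C"
        using blip_boundD[of T C x x' y y'] pos by (simp only: pos_divide_le_eq mult.assoc mem_Collect_eq)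
    qed
    then show ?thesis
      using pos by (simp only: pos_divide_le_eq mult.assoc)
  qed
  then have inf: "blip_bound T (Inf ?A)"
    using nonneg by (simp add: blip_bound_def)
  have lower: "Inf ?A \<le> C" if "blip_bound T C" for C
    using that bdd by (intro cInf_lower) auto
  have eq: "(LEAST C. blip_bound T C) = Inf ?A"
    using inf lower by (rule Least_equality)
  show "blip_bound T (LEAST C. blip_bound T C)"
    using inf eq by simp
  show "(LEAST C. blip_bound T C) \<le> D" if "blip_bound T D"
    using lower[OF that] eq by simp
qed

typedef (overloaded) ('x::real_normed_vector, 'y::real_normed_vector, 'e::real_normed_vector) blip =
  "BLip0_maps :: ('x \<times> 'y \<Rightarrow> 'e) set"
  morphisms blip_apply Blip
  using blip_bound_zero by (intro exI[of _ "\<lambda>_. 0"]) (auto simp: BLip0_maps_def)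

setup_lifting type_definition_blip

lemma blip_eqI: "(\<And>p. blip_apply S p = blip_apply T p) \<Longrightarrow> S = T"
  by (metis blip_apply_inject ext)

lemma blip_apply_axes [simp]: "blip_apply T (x, 0) = 0" "blip_apply T (0, y) = 0"
  using blip_apply[of T] by (auto simp: BLip0_maps_def)

lemma blip_bound_ex: "\<exists>C. blip_bound (blip_apply T) C"
  using blip_apply[of T] by (auto simp: BLip0_maps_def)

instantiation blip :: (real_normed_vector, real_normed_vector, real_normed_vector) real_vector
begin

lift_definition zero_blip :: "('a, 'b, 'c) blip" is "\<lambda>_. 0"
  using blip_bound_zero by (auto simp: BLip0_maps_def)

lift_definition plus_blip :: "('a, 'b, 'c) blip \<Rightarrow> ('a, 'b, 'c) blip \<Rightarrow> ('a, 'b, 'c) blip"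
  is "\<lambda>S T p. S p + T p"
  by (auto simp: BLip0_maps_def intro: blip_bound_add)

lift_definition minus_blip :: "('a, 'b, 'c) blip \<Rightarrow> ('a, 'b, 'c) blip \<Rightarrow> ('a, 'b, 'c) blip"
  is "\<lambda>S T p. S p - T p"
  by (auto simp: BLip0_maps_def intro: blip_bound_diff)

lift_definition uminus_blip :: "('a, 'b, 'c) blip \<Rightarrow> ('a, 'b, 'c) blip"
  is "\<lambda>T p. - T p"
  by (auto simp: BLip0_maps_def intro: blip_bound_uminus)

lift_definition scaleR_blip :: "real \<Rightarrow> ('a, 'b, 'c) blip \<Rightarrow> ('a, 'b, 'c) blip"
  is "\<lambda>r T p. r *\<^sub>R T p"
  by (auto simp: BLip0_maps_def intro: blip_bound_scaleR)

instance
  by standard (transfer; simp add: algebra_simps)+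

end

lemmas blip_apply_simps [simp] =
  zero_blip.rep_eq plus_blip.rep_eq minus_blip.rep_eq uminus_blip.rep_eq scaleR_blip.rep_eq

instantiation blip :: (real_normed_vector, real_normed_vector, real_normed_vector) real_normed_vector
begin

definition norm_blip :: "('a, 'b, 'c) blip \<Rightarrow> real" where
  "norm_blip T = (LEAST C. blip_bound (blip_apply T) C)"

definition dist_blip :: "('a, 'b, 'c) blip \<Rightarrow> ('a, 'b, 'c) blip \<Rightarrow> real" where
  "dist_blip S T = norm (S - T)"

definition sgn_blip :: "('a, 'b, 'c) blip \<Rightarrow> ('a, 'b, 'c) blip" where
  "sgn_blip T = T /\<^sub>R norm T"

definition uniformity_blip :: "(('a, 'b, 'c) blip \<times> ('a, 'b, 'c) blip) filter" where
  "uniformity_blip = (INF e\<in>{0<..}. principal {(S, T). dist S T < e})"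

definition open_blip :: "('a, 'b, 'c) blip set \<Rightarrow> bool" where
  "open_blip U = (\<forall>S\<in>U. \<forall>\<^sub>F (S', T) in uniformity. S' = S \<longrightarrow> T \<in> U)"

lemma blip_bound_norm: "blip_bound (blip_apply T) (norm T)" for T :: "('a, 'b, 'c) blip"
  unfolding norm_blip_def by (rule least_blip_bound(1)[OF blip_bound_ex])

lemma norm_blip_le: "blip_bound (blip_apply T) C \<Longrightarrow> norm T \<le> C" for T :: "('a, 'b, 'c) blip"
  unfolding norm_blip_def by (rule least_blip_bound(2)[OF blip_bound_ex])

lemma norm_blip_apply_le: "norm (blip_apply T (x, y)) \<le> norm T * norm x * norm y"
  for T :: "('a, 'b, 'c) blip"
  using blip_boundD[OF blip_bound_norm, of T x 0 y 0] by (simp add: mixed_diff_def)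

instance
proof
  fix S T :: "('a, 'b, 'c) blip" and r :: real
  have nonneg: "0 \<le> norm U" for U :: "('a, 'b, 'c) blip"
    using blip_bound_norm[of U] by (simp add: blip_bound_def)
  show "norm T = 0 \<longleftrightarrow> T = 0"
  proof
    assume "norm T = 0"
    show "T = 0"
    proof (rule blip_eqI)
      fix p
      show "blip_apply T p = blip_apply 0 p"
        using norm_blip_apply_le[of T "fst p" "snd p"] \<open>norm T = 0\<close> by simp
    qed
  next
    assume "T = 0"
    then have "norm T \<le> 0"
      by (intro norm_blip_le) (simp add: blip_bound_def mixed_diff_def)
    then show "norm T = 0"
      using nonneg[of T] by simp
  qed
  show "norm (S + T) \<le> norm S + norm T"
    using blip_bound_add[OF blip_bound_norm blip_bound_norm, of S T]
    by (intro norm_blip_le) (simp add: plus_blip.rep_eq)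
  have le: "norm (s *\<^sub>R U) \<le> \<bar>s\<bar> * norm U" for s and U :: "('a, 'b, 'c) blip"
    using blip_bound_scaleR[OF blip_bound_norm, of s U]
    by (intro norm_blip_le) (simp add: scaleR_blip.rep_eq)
  show "norm (r *\<^sub>R T) = \<bar>r\<bar> * norm T"
  proof (cases "r = 0")
    case True
    then show ?thesis
      using le[of 0 T] nonneg[of "0 *\<^sub>R T"] by simp
  next
    case False
    have "\<bar>r\<bar> * norm T \<le> \<bar>r\<bar> * (\<bar>inverse r\<bar> * norm (r *\<^sub>R T))"
      using le[of "inverse r" "r *\<^sub>R T"] False by (intro mult_left_mono) auto
    also have "\<dots> = norm (r *\<^sub>R T)"
      using False by (simp add: field_simps)
    finally show ?thesis
      using le[of r T] by simp
  qed
qed (simp_all only: dist_blip_def sgn_blip_def uniformity_blip_def open_blip_def)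

end

instance blip :: (real_normed_vector, real_normed_vector, banach) banach
proof
  fix X :: "nat \<Rightarrow> ('a, 'b, 'c) blip"
  assume X: "Cauchy X"
  have "Cauchy (\<lambda>n. blip_apply (X n) p)" for p
  proof (rule CauchyI)
    fix e :: real assume "0 < e"
    define K where "K = norm (fst p) * norm (snd p) + 1"
    have K: "0 < K"
      unfolding K_def by (simp add: add_nonneg_pos)
    then obtain N where N: "\<And>m n. m \<ge> N \<Longrightarrow> n \<ge> N \<Longrightarrow> norm (X m - X n) < e / K"
      using CauchyD[OF X, of "e / K"] \<open>0 < e\<close> by auto
    have "norm (blip_apply (X m) p - blip_apply (X n) p) < e" if "m \<ge> N" "n \<ge> N" for m n
    proof -
      have "norm (blip_apply (X m - X n) p) \<le> norm (X m - X n) * (norm (fst p) * norm (snd p))"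
        using norm_blip_apply_le[of "X m - X n" "fst p" "snd p"] by (simp add: mult.assoc)
      also have "\<dots> \<le> norm (X m - X n) * K"
        unfolding K_def by (intro mult_left_mono) auto
      also have "\<dots> < e"
        using N[OF that] K by (simp add: pos_less_divide_eq)
      finally show ?thesis by simp
    qed
    then show "\<exists>M. \<forall>m\<ge>M. \<forall>n\<ge>M. norm (blip_apply (X m) p - blip_apply (X n) p) < e"
      by blast
  qed
  then have "\<exists>l. (\<lambda>n. blip_apply (X n) p) \<longlonglongrightarrow> l" for p
    by (simp add: Cauchy_convergent_iff convergent_def)
  then obtain L where L: "\<And>p. (\<lambda>n. blip_apply (X n) p) \<longlonglongrightarrow> L p"
    by metis
  have bound: "\<exists>N. \<forall>n\<ge>N. blip_bound (\<lambda>p. blip_apply (X n) p - L p) e" if e: "0 < e" for e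
  proof -
    obtain N where N: "\<And>m n. m \<ge> N \<Longrightarrow> n \<ge> N \<Longrightarrow> norm (X m - X n) < e"
      using CauchyD[OF X e] by blast
    have "norm (mixed_diff (\<lambda>p. blip_apply (X n) p - L p) x x' y y') \<le> e * norm (x - x') * norm (y - y')"
      if n: "n \<ge> N" for n x x' y y'
    proof (rule Lim_norm_ubound[OF trivial_limit_sequentially])
      show "(\<lambda>m. mixed_diff (\<lambda>p. blip_apply (X n) p - blip_apply (X m) p) x x' y y')
              \<longlonglongrightarrow> mixed_diff (\<lambda>p. blip_apply (X n) p - L p) x x' y y'"
        unfolding mixed_diff_def by (intro tendsto_intros L)
      show "\<forall>\<^sub>F m in sequentially.
              norm (mixed_diff (\<lambda>p. blip_apply (X n) p - blip_apply (X m) p) x x' y y')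
                \<le> e * norm (x - x') * norm (y - y')"
      proof (rule eventually_sequentiallyI)
        fix m assume "m \<ge> N"
        have "norm (mixed_diff (blip_apply (X n - X m)) x x' y y')
                \<le> norm (X n - X m) * norm (x - x') * norm (y - y')"
          by (rule blip_boundD[OF blip_bound_norm])
        also have "\<dots> \<le> e * norm (x - x') * norm (y - y')"
          using N[OF n \<open>m \<ge> N\<close>] by (intro mult_right_mono) auto
        finally show "norm (mixed_diff (\<lambda>p. blip_apply (X n) p - blip_apply (X m) p) x x' y y')
                \<le> e * norm (x - x') * norm (y - y')"
          by (simp add: minus_blip.rep_eq)
      qed
    qed
    then show ?thesis
      using \<open>0 < e\<close> unfolding blip_bound_def by (meson less_imp_le)
  qed
  have "L \<in> BLip0_maps"
  proof -
    obtain n where "blip_bound (\<lambda>p. blip_apply (X n) p - L p) 1"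
      using bound[of 1] by auto
    from blip_bound_diff[OF blip_bound_norm[of "X n"] this] have "\<exists>C. blip_bound L C"
      by auto
    moreover have "L (x, 0) = 0" "L (0, y) = 0" for x y
      using L[of "(x, 0)"] L[of "(0, y)"] by (simp_all add: LIMSEQ_const_iff)
    ultimately show ?thesis
      by (auto simp: BLip0_maps_def)
  qed
  then have app: "blip_apply (Blip L) = L"
    by (rule Blip_inverse)
  have "X \<longlonglongrightarrow> Blip L"
  proof (rule LIMSEQ_I)
    fix e :: real assume "0 < e"
    then obtain N where N: "\<forall>n\<ge>N. blip_bound (\<lambda>p. blip_apply (X n) p - L p) (e / 2)"
      using bound[of "e / 2"] by auto
    have "norm (X n - Blip L) < e" if "n \<ge> N" for n
    proof -
      have "norm (X n - Blip L) \<le> e / 2"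
        using N that by (intro norm_blip_le) (simp add: minus_blip.rep_eq app)
      then show ?thesis
        using \<open>0 < e\<close> by simp
    qed
    then show "\<exists>N. \<forall>n\<ge>N. norm (X n - Blip L) < e"
      by blast
  qed
  then show "convergent X"
    by (rule convergentI)
qed


section \<open>Isometric representations\<close>

definition surj_linear_isometry ::
  "('v::real_normed_vector \<Rightarrow> 'w::real_normed_vector) \<Rightarrow> bool" where
  "surj_linear_isometry f \<longleftrightarrow> linear f \<and> surj f \<and> (\<forall>v. norm (f v) = norm v)"

definition isometry_group :: "('v::real_normed_vector \<Rightarrow> 'v) monoid" where
  "isometry_group = \<lparr>carrier = {f. surj_linear_isometry f}, monoid.mult = (\<circ>), one = id\<rparr>"

definition additive_group :: "('g::group_add) monoid" where
  "additive_group = \<lparr>carrier = UNIV, monoid.mult = (+), one = 0\<rparr>"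

definition isometric_representation ::
  "('g, 'r) monoid_scheme \<Rightarrow> ('g \<Rightarrow> 'v::banach \<Rightarrow> 'v) \<Rightarrow> bool" where
  "isometric_representation G \<pi> \<longleftrightarrow> group_hom G isometry_group \<pi>"

lemma group_additive_group: "group (additive_group :: 'g::group_add monoid)"
proof (rule groupI)
  fix g :: 'g assume "g \<in> carrier additive_group"
  show "\<exists>h\<in>carrier additive_group. h \<otimes>\<^bsub>additive_group\<^esub> g = \<one>\<^bsub>additive_group\<^esub>"
    by (rule bexI[of _ "- g"]) (simp_all add: additive_group_def)
qed (simp_all add: additive_group_def add.assoc)

lemma group_isometry_group: "group (isometry_group :: ('v::real_normed_vector \<Rightarrow> 'v) monoid)"
proof (rule groupI)
  fix f :: "'v \<Rightarrow> 'v" assume "f \<in> carrier isometry_group"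
  then have f: "linear f" "surj f" "\<And>v. norm (f v) = norm v"
    by (simp_all add: isometry_group_def surj_linear_isometry_def)
  have "inj f"
    unfolding linear_injective_0[OF f(1)] using f(3) norm_eq_zero by metis
  define g where "g = inv_into UNIV f"
  have fg: "f (g v) = v" and gf: "g (f v) = v" for v
    unfolding g_def using f(2) \<open>inj f\<close> by (simp_all add: surj_f_inv_f)
  have "linear g"
  proof (rule linearI)
    show "g (u + v) = g u + g v" for u v
      using fg gf linear_add[OF f(1), of "g u" "g v"] by metis
    show "g (r *\<^sub>R v) = r *\<^sub>R g v" for r v
      using fg gf linear_scale[OF f(1), of r "g v"] by metis
  qed
  moreover have "surj g"
    using gf by (rule surjI)
  moreover have "norm (g v) = norm v" for v
    using f(3)[of "g v"] fg by simp
  ultimately have "g \<in> carrier isometry_group"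
    by (simp add: isometry_group_def surj_linear_isometry_def)
  moreover have "g \<otimes>\<^bsub>isometry_group\<^esub> f = \<one>\<^bsub>isometry_group\<^esub>"
    using gf by (auto simp: isometry_group_def)
  ultimately show "\<exists>g\<in>carrier isometry_group. g \<otimes>\<^bsub>isometry_group\<^esub> f = \<one>\<^bsub>isometry_group\<^esub>"
    by blast
next
  fix f g :: "'v \<Rightarrow> 'v"
  assume "f \<in> carrier isometry_group" "g \<in> carrier isometry_group"
  then show "f \<otimes>\<^bsub>isometry_group\<^esub> g \<in> carrier isometry_group"
    using comp_surj[of g f]
    by (simp add: isometry_group_def surj_linear_isometry_def linear_compose o_def linear_compose[unfolded o_def])
next
  show "\<one>\<^bsub>isometry_group\<^esub> \<in> carrier isometry_group"
    by (simp add: isometry_group_def surj_linear_isometry_def linear_iff)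
qed (simp_all add: isometry_group_def comp_assoc)


section \<open>The translation operators\<close>

text \<open>\<^const>\<open>Blip\<close> is unspecified outside \<^const>\<open>BLip0_maps\<close>, so that the translates below
  belong to the space is not part of the definitions; it has to be stated and proved.\<close>

definition rho_X :: "'x::real_normed_vector \<Rightarrow>
    ('x, 'y::real_normed_vector, 'e::real_normed_vector) blip \<Rightarrow> ('x, 'y, 'e) blip" where
  "rho_X a T = Blip (\<lambda>(x, y). blip_apply T (x + a, y) - blip_apply T (a, y))"

definition rho_Y :: "'y::real_normed_vector \<Rightarrow>
    ('x::real_normed_vector, 'y, 'e::real_normed_vector) blip \<Rightarrow> ('x, 'y, 'e) blip" where
  "rho_Y b T = Blip (\<lambda>(x, y). blip_apply T (x, y + b) - blip_apply T (x, b))"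

definition rho :: "'x::real_normed_vector \<times> 'y::real_normed_vector \<Rightarrow>
    ('x, 'y, 'e::real_normed_vector) blip \<Rightarrow> ('x, 'y, 'e) blip" where
  "rho = (\<lambda>(a, b) T. rho_X a (rho_Y b T))"

end

theory Submission
  imports Defs
begin

text \<open>
  The mixed difference of \<open>T\<close> over a rectangle is unchanged when a function of one variable alone is
  added to \<open>T\<close>. The term subtracted in \<open>rho_X a T\<close> depends on \<open>y\<close> alone, so the mixed differences of
  \<open>rho_X a T\<close> are those of \<open>T\<close> over translated rectangles, and since translation preserves the side
  lengths of a rectangle, \<open>rho_X a T\<close> has every two-Lipschitz bound of \<open>T\<close>. The subtracted term is
  what restores the vanishing on the axes. Hence \<open>rho_X a\<close> is a well-defined linear contraction, and
  likewise \<open>rho_Y b\<close>.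

  The algebraic identities are pointwise telescoping. In particular \<open>rho_X\<close>, \<open>rho_Y\<close> and \<open>rho\<close> are
  additive actions by linear contractions. Each operator then has a contractive inverse, the one
  belonging to the negative of the group element, and is therefore a surjective isometry
  (\<open>contractive_action_surj_linear_isometry\<close>).
\<close>

text \<open>
  Contractivity of \<open>f g\<close> gives one inequality between the norms, and contractivity of its inverse
  \<open>f (- g)\<close> gives the other.
\<close>

lemma contractive_action_surj_linear_isometry:
  fixes f :: "'g::group_add \<Rightarrow> 'v::real_normed_vector \<Rightarrow> 'v"
  assumes lin: "\<And>g. linear (f g)"
    and zero: "\<And>v. f 0 v = v"
    and add: "\<And>g h v. f g (f h v) = f (g + h) v"
    and contr: "\<And>g v. norm (f g v) \<le> norm v"
  shows "surj_linear_isometry (f g)"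
proof -
  have "f g (f (- g) v) = v" for v
    by (simp add: add zero)
  then have "surj (f g)"
    by (rule surjI)
  moreover have "norm (f g v) = norm v" for v
  proof (rule antisym)
    have "norm v = norm (f (- g) (f g v))"
      by (simp add: add zero)
    also have "\<dots> \<le> norm (f g v)"
      by (rule contr)
    finally show "norm v \<le> norm (f g v)" .
  qed (rule contr)
  ultimately show ?thesis
    using lin by (simp add: surj_linear_isometry_def)
qed

lemma blip_bound_translate_fst:
  assumes "blip_bound T C"
  shows "blip_bound (\<lambda>(x, y). T (x + a, y) - T (a, y)) C"
  unfolding blip_bound_def
proof (intro conjI allI)
  fix x x' y y'
  have "mixed_diff (\<lambda>(x, y). T (x + a, y) - T (a, y)) x x' y y' = mixed_diff T (x + a) (x' + a) y y'"
    by (simp add: mixed_diff_def)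
  then show "norm (mixed_diff (\<lambda>(x, y). T (x + a, y) - T (a, y)) x x' y y')
      \<le> C * norm (x - x') * norm (y - y')"
    using blip_boundD[OF assms, of "x + a" "x' + a" y y'] by simp
qed (use assms in \<open>simp add: blip_bound_def\<close>)

lemma blip_bound_translate_snd:
  assumes "blip_bound T C"
  shows "blip_bound (\<lambda>(x, y). T (x, y + b) - T (x, b)) C"
  unfolding blip_bound_def
proof (intro conjI allI)
  fix x x' y y'
  have "mixed_diff (\<lambda>(x, y). T (x, y + b) - T (x, b)) x x' y y' = mixed_diff T x x' (y + b) (y' + b)"
    by (simp add: mixed_diff_def)
  then show "norm (mixed_diff (\<lambda>(x, y). T (x, y + b) - T (x, b)) x x' y y')
      \<le> C * norm (x - x') * norm (y - y')"
    using blip_boundD[OF assms, of x x' "y + b" "y' + b"] by simp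
qed (use assms in \<open>simp add: blip_bound_def\<close>)

lemma translate_fst_in_BLip0_maps:
  "(\<lambda>(x, y). blip_apply T (x + a, y) - blip_apply T (a, y)) \<in> BLip0_maps"
  using blip_bound_translate_fst[OF blip_bound_norm[of T], of a] by (auto simp: BLip0_maps_def)

lemma translate_snd_in_BLip0_maps:
  "(\<lambda>(x, y). blip_apply T (x, y + b) - blip_apply T (x, b)) \<in> BLip0_maps"
  using blip_bound_translate_snd[OF blip_bound_norm[of T], of b] by (auto simp: BLip0_maps_def)

lemma blip_apply_rho_X:
  "blip_apply (rho_X a T) = (\<lambda>(x, y). blip_apply T (x + a, y) - blip_apply T (a, y))"
  unfolding rho_X_def by (rule Blip_inverse[OF translate_fst_in_BLip0_maps])

lemma blip_apply_rho_Y: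
  "blip_apply (rho_Y b T) = (\<lambda>(x, y). blip_apply T (x, y + b) - blip_apply T (x, b))"
  unfolding rho_Y_def by (rule Blip_inverse[OF translate_snd_in_BLip0_maps])

lemma norm_rho_X_le: "norm (rho_X a T) \<le> norm T"
  by (rule norm_blip_le)
    (simp add: blip_apply_rho_X blip_bound_translate_fst[OF blip_bound_norm])

lemma norm_rho_Y_le: "norm (rho_Y b T) \<le> norm T"
  by (rule norm_blip_le)
    (simp add: blip_apply_rho_Y blip_bound_translate_snd[OF blip_bound_norm])

lemma linear_rho_X: "linear (rho_X a)"
  by (intro linearI blip_eqI) (auto simp: blip_apply_rho_X scaleR_diff_right)

lemma linear_rho_Y: "linear (rho_Y b)"
  by (intro linearI blip_eqI) (auto simp: blip_apply_rho_Y scaleR_diff_right)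

lemma rho_X_zero: "rho_X 0 T = T"
  by (rule blip_eqI) (auto simp: blip_apply_rho_X)

lemma rho_Y_zero: "rho_Y 0 T = T"
  by (rule blip_eqI) (auto simp: blip_apply_rho_Y)

lemma rho_X_rho_X: "rho_X a (rho_X c T) = rho_X (a + c) T"
  by (rule blip_eqI) (auto simp: blip_apply_rho_X add.assoc)

lemma rho_Y_rho_Y: "rho_Y b (rho_Y d T) = rho_Y (b + d) T"
  by (rule blip_eqI) (auto simp: blip_apply_rho_Y add.assoc)

lemma rho_X_rho_Y_commute: "rho_X a (rho_Y b T) = rho_Y b (rho_X a T)"
  by (rule blip_eqI) (auto simp: blip_apply_rho_X blip_apply_rho_Y)

lemma surj_linear_isometry_rho_X: "surj_linear_isometry (rho_X a)"
  by (rule contractive_action_surj_linear_isometry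
      [OF linear_rho_X rho_X_zero rho_X_rho_X norm_rho_X_le])

lemma surj_linear_isometry_rho_Y: "surj_linear_isometry (rho_Y b)"
  by (rule contractive_action_surj_linear_isometry
      [OF linear_rho_Y rho_Y_zero rho_Y_rho_Y norm_rho_Y_le])

lemma blip_apply_rho:
  "blip_apply (rho (a, b) T) (x, y) =
     blip_apply T (x + a, y + b) - blip_apply T (x + a, b) - blip_apply T (a, y + b)
       + blip_apply T (a, b)"
  by (simp add: rho_def blip_apply_rho_X blip_apply_rho_Y)

text \<open>
  Commutation of the two partial translations is what allows the factors of
  \<open>rho p \<circ> rho q\<close> to be regrouped coordinate by coordinate.
\<close>

lemma rho_rho: "rho p (rho q T) = rho (p + q) T"
proof -
  obtain a b c d where pq: "p = (a, b)" "q = (c, d)"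
    by fastforce
  have "rho p (rho q T) = rho_X a (rho_Y b (rho_X c (rho_Y d T)))"
    by (simp add: rho_def pq)
  also have "\<dots> = rho_X a (rho_X c (rho_Y b (rho_Y d T)))"
    by (simp only: rho_X_rho_Y_commute)
  also have "\<dots> = rho (p + q) T"
    by (simp add: rho_def pq rho_X_rho_X rho_Y_rho_Y)
  finally show ?thesis .
qed

lemma surj_linear_isometry_rho:
  fixes p :: "'x::real_normed_vector \<times> 'y::real_normed_vector"
  shows "surj_linear_isometry (rho p :: ('x, 'y, 'e::real_normed_vector) blip \<Rightarrow> _)"
proof (rule contractive_action_surj_linear_isometry[OF _ _ rho_rho])
  fix p :: "'x \<times> 'y" and T :: "('x, 'y, 'e) blip"
  have "(rho p :: ('x, 'y, 'e) blip \<Rightarrow> _) = rho_X (fst p) \<circ> rho_Y (snd p)"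
    by (simp add: rho_def fun_eq_iff split: prod.split)
  then show "linear (rho p :: ('x, 'y, 'e) blip \<Rightarrow> _)"
    using linear_compose[OF linear_rho_Y linear_rho_X] by metis
  show "norm (rho p T) \<le> norm T"
    by (auto simp: rho_def split: prod.split intro: order_trans[OF norm_rho_X_le norm_rho_Y_le])
  show "rho 0 T = T"
    by (simp add: rho_def zero_prod_def rho_X_zero rho_Y_zero)
qed

lemma isometric_representation_rho: "isometric_representation additive_group rho"
  unfolding isometric_representation_def
proof (intro group_hom.intro group_hom_axioms.intro homI)
  fix p q
  show "rho p \<in> carrier isometry_group"
    by (simp add: isometry_group_def surj_linear_isometry_rho)
  show "rho (p \<otimes>\<^bsub>additive_group\<^esub> q) = rho p \<otimes>\<^bsub>isometry_group\<^esub> rho q"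
    by (simp add: additive_group_def isometry_group_def fun_eq_iff rho_rho)
qed (rule group_additive_group group_isometry_group)+

theorem proposition4p10:
  shows
    "(\<forall>(a::'x::banach) (T::('x, 'y::banach, 'e::banach) blip).
        (\<lambda>(x, y). blip_apply T (x + a, y) - blip_apply T (a, y)) \<in> BLip0_maps \<and>
        (\<forall>x y. blip_apply (rho_X a T) (x, y) = blip_apply T (x + a, y) - blip_apply T (a, y))) \<and>
     (\<forall>(b::'y) (T::('x, 'y, 'e) blip).
        (\<lambda>(x, y). blip_apply T (x, y + b) - blip_apply T (x, b)) \<in> BLip0_maps \<and>
        (\<forall>x y. blip_apply (rho_Y b T) (x, y) = blip_apply T (x, y + b) - blip_apply T (x, b))) \<and>
     (\<forall>a::'x. surj_linear_isometry (rho_X a :: ('x, 'y, 'e) blip \<Rightarrow> ('x, 'y, 'e) blip)) \<and>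
     (\<forall>b::'y. surj_linear_isometry (rho_Y b :: ('x, 'y, 'e) blip \<Rightarrow> ('x, 'y, 'e) blip)) \<and>
     (\<forall>a c::'x. rho_X a \<circ> rho_X c = (rho_X (a + c) :: ('x, 'y, 'e) blip \<Rightarrow> ('x, 'y, 'e) blip)) \<and>
     (\<forall>b d::'y. rho_Y b \<circ> rho_Y d = (rho_Y (b + d) :: ('x, 'y, 'e) blip \<Rightarrow> ('x, 'y, 'e) blip)) \<and>
     (\<forall>(a::'x) (b::'y). rho_X a \<circ> rho_Y b =
        (rho_Y b \<circ> rho_X a :: ('x, 'y, 'e) blip \<Rightarrow> ('x, 'y, 'e) blip)) \<and>
     isometric_representation (additive_group :: ('x \<times> 'y) monoid)
       (rho :: 'x \<times> 'y \<Rightarrow> ('x, 'y, 'e) blip \<Rightarrow> ('x, 'y, 'e) blip) \<and>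
     (\<forall>(a::'x) (b::'y) (T::('x, 'y, 'e) blip) x y. blip_apply (rho (a, b) T) (x, y) =
        blip_apply T (x + a, y + b) - blip_apply T (x + a, b) - blip_apply T (a, y + b)
          + blip_apply T (a, b))"
  by (intro conjI allI)
    (simp_all add: translate_fst_in_BLip0_maps translate_snd_in_BLip0_maps blip_apply_rho_X
    blip_apply_rho_Y blip_apply_rho surj_linear_isometry_rho_X surj_linear_isometry_rho_Y
    rho_X_rho_X rho_Y_rho_Y rho_X_rho_Y_commute isometric_representation_rho fun_eq_iff)

end
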